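(* Let $\mathcal{C}$ be a fully triangulated category and let $(f,g,h)$ be a distinguished map of $2$-triangles from $a\xrightarrow{u}b\xrightarrow{v}c\xrightarrow{w}a[1]$ to $a'\xrightarrow{u'}b'\xrightarrow{v'}c'\xrightarrow{w'}a'[1]$. Then for every morphism $\theta:a[1]\to b'$, the map $(f,g,h+v'\theta w)$ between the same two $2$-triangles is also distinguished.
   Context: Setting. $\mathcal{C}$ is an additive category with an additive automorphism $[1]$. For $n\ge 1$, an $n$-triangle (or $R_n$-diagram) $A$ in $\mathcal{C}$ consists of objects $a_{i,j}$ ($0\le i<j\le n$) and, for all $0\le i<j<k\le n$, morphisms (edges) (i) $a_{i,j}\to a_{i,k}$, (ii) $a_{i,k}\to a_{j,k}$, (iii) $a_{j,k}\to a_{i,j}[1]$ ("degree-one edges"), such that: (S) for each index $m$, the edges among $a_{m,m+1},\dots,a_{m,n},a_{0,m}[1],\dots,a_{m-1,m}[1]$ (shifted where needed) form a commuting diagram, so that each edge is the composite of consecutive ones; (Q) for $i<j<k<l$ the squares $a_{i,k}\to a_{i,l}\to a_{j,l}$ $=$ $a_{i,k}\to a_{j,k}\to a_{j,l}$ and $a_{j,l}\to a_{k,l}\to a_{i,k}[1]$ $=$ $a_{j,l}\to a_{i,j}[1]\to a_{i,k}[1]$ commute. A morphism of $n$-triangles is a family of morphisms between corresponding objects commuting with all edges (with $[1]$ applied where appropriate); this gives a category $\Pi_n$. A $2$-triangle is a diagram $a\xrightarrow{u}b\xrightarrow{v}c\xrightarrow{w}a[1]$ ($a=a_{0,1}$,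 $b=a_{0,2}$, $c=a_{1,2}$), written $(u,v,w)$, and a morphism $(f,g,h):(u,v,w)\to(u',v',w')$ satisfies $gu=u'f$, $hv=v'g$, $f[1]w=w'h$. Faces and degeneracies. For $0\le m\le n$ the face functor $F_m:\Pi_n\to\Pi_{n-1}$ discards all objects having $m$ as an index (and relabels the remaining indices in order). The degeneracy functor $\Pi_{n-1}\to\Pi_n$ repeats index $m$: with $s:\{0,\dots,n\}\to\{0,\dots,n-1\}$ the monotone surjection hitting $m$ twice, the new object at $(i,j)$ is $a_{s(i),s(j)}$ if $s(i)\ne s(j)$ and $0$ otherwise, with the evident edges (original edges, identities or zeros). Base. An $(n-1)$-simplex diagram is a commuting diagram on a chain $x_1\to x_2\to\cdots\to x_n$; the base of $A$ is $a_{0,1}\to a_{0,2}\to\cdots\to a_{0,n}$. Rotations. $\tau(A)$ has objects $\tau(A)_{0,j}=a_{j-1,n}$ and $\tau(A)_{i,j}=a_{i-1,j-1}[1]$ for $1\le i<j$, with the corresponding (shifted) edges of $A$ but with all degree-one edges of $\tau(A)$ multiplied by $-1$ (for $n=2$: $b\xrightarrow{v}c\xrightarrow{w}a[1]\xrightarrow{-u[1]}b[1]$). $\sigma(A)$ has objects $a_{i,j}[1]$, shifted edges, with degree-one edges multiplied by $-1$. $\mathcal{C}$ is fully triangulated if for each $n\ge2$ there is given a subcategory $D_n\subset\Pi_n$, whose objects are called distinguished $n$-triangles and whose morphisms are called distinguished morphisms (maps), such that for all $n\geq 2$: (1) Isomorphism: any isomorphism between objects of $D_n$ is distinguished, and any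 object of $\Pi_n$ isomorphic to a distinguished $n$-triangle is distinguished. (2) Rotation: if $A\in D_n$ then $\tau(A),\sigma(A)\in D_n$. (3) Faces: for $n>2$, face functors send distinguished maps of $n$-triangles to distinguished maps of $(n-1)$-triangles, and degeneracy functors send distinguished maps of $(n-1)$-triangles to distinguished maps of $n$-triangles. (4) Bases: every $(n-1)$-simplex diagram is the base of some distinguished $n$-triangle, and every map of $(n-1)$-simplex diagrams $\Sigma\to\Sigma'$ extends to a distinguished map between any given distinguished $n$-triangles with bases $\Sigma,\Sigma'$. (5) Lightning strike: if $(f,g,h)$ and $(f,g,h')$ are distinguished maps between the same two distinguished $2$-triangles $(u,v,w)$ and $(u',v',w')$, then $h'-h=v'\theta w$ for some $\theta:a[1]\to b'$. *)

theory Defs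
  imports "HOL-Algebra.Group"
begin

section \<open>Additive categories with an additive automorphism\<close>

record ('o, 'm) category =
  ob :: "'o set"
  ar :: "'m set"
  src :: "'m \<Rightarrow> 'o"
  trg :: "'m \<Rightarrow> 'o"
  cmp :: "'m \<Rightarrow> 'm \<Rightarrow> 'm"  (infixr \<open>\<cdot>\<index>\<close> 70)
  idt :: "'o \<Rightarrow> 'm"

definition Hom :: "('o, 'm, 'x) category_scheme \<Rightarrow> 'o \<Rightarrow> 'o \<Rightarrow> 'm set" where
  "Hom C a b = {f \<in> ar C. src C f = a \<and> trg C f = b}"

text \<open>Composition is written in the usual order: \<open>g \<cdot> f\<close> is \<open>f\<close> followed by \<open>g\<close>.\<close>

locale category =
  fixes C (structure)
  assumes src_ob: "f \<in> ar C \<Longrightarrow> src C f \<in> ob C"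
    and trg_ob: "f \<in> ar C \<Longrightarrow> trg C f \<in> ob C"
    and idt_Hom: "a \<in> ob C \<Longrightarrow> idt C a \<in> Hom C a a"
    and cmp_Hom: "\<lbrakk>f \<in> Hom C a b; g \<in> Hom C b c\<rbrakk> \<Longrightarrow> g \<cdot> f \<in> Hom C a c"
    and cmp_idt: "f \<in> Hom C a b \<Longrightarrow> f \<cdot> idt C a = f"
    and idt_cmp: "f \<in> Hom C a b \<Longrightarrow> idt C b \<cdot> f = f"
    and cmp_assoc: "\<lbrakk>f \<in> Hom C a b; g \<in> Hom C b c; h \<in> Hom C c d\<rbrakk>
      \<Longrightarrow> (h \<cdot> g) \<cdot> f = h \<cdot> (g \<cdot> f)"

definition iso_arrow :: "('o, 'm, 'x) category_scheme \<Rightarrow> 'm \<Rightarrow> bool" where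
  "iso_arrow C f \<longleftrightarrow> f \<in> ar C \<and>
    (\<exists>g \<in> Hom C (trg C f) (src C f).
      cmp C g f = idt C (src C f) \<and> cmp C f g = idt C (trg C f))"

text \<open>A subcategory is given by its set of objects and its set of arrows.\<close>

definition subcategory :: "('o, 'm, 'x) category_scheme \<Rightarrow> 'o set \<Rightarrow> 'm set \<Rightarrow> bool" where
  "subcategory C X M \<longleftrightarrow>
    X \<subseteq> ob C \<and> M \<subseteq> ar C \<and>
    (\<forall>f \<in> M. src C f \<in> X \<and> trg C f \<in> X) \<and>
    (\<forall>a \<in> X. idt C a \<in> M) \<and>
    (\<forall>f \<in> M. \<forall>g \<in> M. trg C f = src C g \<longrightarrow> cmp C g f \<in> M)"

record ('o, 'm) additive_category = "('o, 'm) category" +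
  plus_ar :: "'m \<Rightarrow> 'm \<Rightarrow> 'm"  (infixl \<open>\<oplus>\<index>\<close> 65)
  zero_ar :: "'o \<Rightarrow> 'o \<Rightarrow> 'm"

definition hom_group :: "('o, 'm, 'x) additive_category_scheme \<Rightarrow> 'o \<Rightarrow> 'o \<Rightarrow> 'm monoid" where
  "hom_group C a b = \<lparr>carrier = Hom C a b, monoid.mult = plus_ar C, one = zero_ar C a b\<rparr>"

definition neg_ar :: "('o, 'm, 'x) additive_category_scheme \<Rightarrow> 'm \<Rightarrow> 'm" where
  "neg_ar C f = inv\<^bsub>hom_group C (src C f) (trg C f)\<^esub> f"

definition zero_object :: "('o, 'm, 'x) category_scheme \<Rightarrow> 'o \<Rightarrow> bool" where
  "zero_object C z \<longleftrightarrow> z \<in> ob C \<and>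
    (\<forall>a \<in> ob C. (\<exists>!f. f \<in> Hom C a z) \<and> (\<exists>!f. f \<in> Hom C z a))"

definition zero_ob :: "('o, 'm, 'x) category_scheme \<Rightarrow> 'o" where
  "zero_ob C = (SOME z. zero_object C z)"

definition biproduct :: "('o, 'm, 'x) additive_category_scheme \<Rightarrow> 'o \<Rightarrow> 'o \<Rightarrow> 'o \<Rightarrow>
    'm \<Rightarrow> 'm \<Rightarrow> 'm \<Rightarrow> 'm \<Rightarrow> bool" where
  "biproduct C a b s i j p q \<longleftrightarrow>
    s \<in> ob C \<and> i \<in> Hom C a s \<and> j \<in> Hom C b s \<and> p \<in> Hom C s a \<and> q \<in> Hom C s b \<and>
    cmp C p i = idt C a \<and> cmp C q j = idt C b \<and>
    cmp C p j = zero_ar C b a \<and> cmp C q i = zero_ar C a b \<and>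
    plus_ar C (cmp C i p) (cmp C j q) = idt C s"

locale additive_category = category C for C (structure) +
  assumes hom_comm_group: "\<lbrakk>a \<in> ob C; b \<in> ob C\<rbrakk> \<Longrightarrow> comm_group (hom_group C a b)"
    and cmp_plus_left: "\<lbrakk>f \<in> Hom C a b; g \<in> Hom C b c; h \<in> Hom C b c\<rbrakk>
      \<Longrightarrow> (g \<oplus> h) \<cdot> f = (g \<cdot> f) \<oplus> (h \<cdot> f)"
    and cmp_plus_right: "\<lbrakk>f \<in> Hom C a b; g \<in> Hom C a b; h \<in> Hom C b c\<rbrakk>
      \<Longrightarrow> h \<cdot> (f \<oplus> g) = (h \<cdot> f) \<oplus> (h \<cdot> g)"
    and zero_object_exists: "\<exists>z. zero_object C z"
    and biproduct_exists: "\<lbrakk>a \<in> ob C; b \<in> ob C\<rbrakk> \<Longrightarrow> \<exists>s i j p q. biproduct C a b s i j p q"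

text \<open>\<open>shO\<close> and \<open>shM\<close> are the action of \<open>[1]\<close> on objects and on morphisms.\<close>

record ('o, 'm) shift_category = "('o, 'm) additive_category" +
  shO :: "'o \<Rightarrow> 'o"
  shM :: "'m \<Rightarrow> 'm"

locale shift_category = additive_category C for C (structure) +
  assumes shO_bij: "bij_betw (shO C) (ob C) (ob C)"
    and shM_bij: "bij_betw (shM C) (ar C) (ar C)"
    and shM_Hom: "f \<in> Hom C a b \<Longrightarrow> shM C f \<in> Hom C (shO C a) (shO C b)"
    and shM_idt: "a \<in> ob C \<Longrightarrow> shM C (idt C a) = idt C (shO C a)"
    and shM_cmp: "\<lbrakk>f \<in> Hom C a b; g \<in> Hom C b c\<rbrakk> \<Longrightarrow> shM C (g \<cdot> f) = shM C g \<cdot> shM C f"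
    and shM_plus: "\<lbrakk>f \<in> Hom C a b; g \<in> Hom C a b\<rbrakk> \<Longrightarrow> shM C (f \<oplus> g) = shM C f \<oplus> shM C g"


section \<open>The category of \<open>n\<close>-triangles\<close>

definition I2 :: "nat \<Rightarrow> (nat \<times> nat) set" where
  "I2 n = {(i, j). i < j \<and> j \<le> n}"

definition I3 :: "nat \<Rightarrow> (nat \<times> nat \<times> nat) set" where
  "I3 n = {(i, j, k). i < j \<and> j < k \<and> k \<le> n}"

text \<open>
  The edges indexed by \<open>(i, j, k)\<close> are
  \<open>edge1 : a\<^sub>i\<^sub>j \<rightarrow> a\<^sub>i\<^sub>k\<close>, \<open>edge2 : a\<^sub>i\<^sub>k \<rightarrow> a\<^sub>j\<^sub>k\<close> and \<open>edge3 : a\<^sub>j\<^sub>k \<rightarrow> a\<^sub>i\<^sub>j[1]\<close>.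
  All families are extensional (\<open>undefined\<close> off their index set), so that HOL equality
  is equality of families.
\<close>

record ('o, 'm) ntri =
  vert :: "nat \<times> nat \<Rightarrow> 'o"
  edge1 :: "nat \<times> nat \<times> nat \<Rightarrow> 'm"
  edge2 :: "nat \<times> nat \<times> nat \<Rightarrow> 'm"
  edge3 :: "nat \<times> nat \<times> nat \<Rightarrow> 'm"

definition ntri_typed :: "('o, 'm, 'x) shift_category_scheme \<Rightarrow> nat \<Rightarrow> ('o, 'm) ntri \<Rightarrow> bool" where
  "ntri_typed C n A \<longleftrightarrow>
    vert A \<in> I2 n \<rightarrow>\<^sub>E ob C \<and>
    edge1 A \<in> extensional (I3 n) \<and> edge2 A \<in> extensional (I3 n) \<and> edge3 A \<in> extensional (I3 n) \<and>
    (\<forall>i j k. i < j \<and> j < k \<and> k \<le> n \<longrightarrow>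
      edge1 A (i, j, k) \<in> Hom C (vert A (i, j)) (vert A (i, k)) \<and>
      edge2 A (i, j, k) \<in> Hom C (vert A (i, k)) (vert A (j, k)) \<and>
      edge3 A (i, j, k) \<in> Hom C (vert A (j, k)) (shO C (vert A (i, j))))"

text \<open>
  Condition (S): in the chain \<open>a\<^sub>m\<^sub>,\<^sub>m\<^sub>+\<^sub>1 \<rightarrow> \<dots> \<rightarrow> a\<^sub>m\<^sub>,\<^sub>n \<rightarrow> a\<^sub>0\<^sub>,\<^sub>m[1] \<rightarrow> \<dots> \<rightarrow> a\<^sub>m\<^sub>-\<^sub>1\<^sub>,\<^sub>m[1]\<close>
  the composite of two edges is the edge between the outer objects. The four cases are
  distinguished by how many of the three objects involved are of the form \<open>a\<^sub>i\<^sub>m[1]\<close>.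
\<close>

definition ntri_S :: "('o, 'm, 'x) shift_category_scheme \<Rightarrow> nat \<Rightarrow> ('o, 'm) ntri \<Rightarrow> bool" where
  "ntri_S C n A \<longleftrightarrow> (\<forall>m \<le> n.
    (\<forall>j k l. m < j \<and> j < k \<and> k < l \<and> l \<le> n \<longrightarrow>
      cmp C (edge1 A (m, k, l)) (edge1 A (m, j, k)) = edge1 A (m, j, l)) \<and>
    (\<forall>i k l. i < m \<and> m < k \<and> k < l \<and> l \<le> n \<longrightarrow>
      cmp C (edge3 A (i, m, l)) (edge1 A (m, k, l)) = edge3 A (i, m, k)) \<and>
    (\<forall>i j l. i < j \<and> j < m \<and> m < l \<and> l \<le> n \<longrightarrow>
      cmp C (shM C (edge2 A (i, j, m))) (edge3 A (i, m, l)) = edge3 A (j, m, l)) \<and>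
    (\<forall>i j k. i < j \<and> j < k \<and> k < m \<longrightarrow>
      cmp C (shM C (edge2 A (j, k, m))) (shM C (edge2 A (i, j, m))) = shM C (edge2 A (i, k, m))))"

definition ntri_Q :: "('o, 'm, 'x) shift_category_scheme \<Rightarrow> nat \<Rightarrow> ('o, 'm) ntri \<Rightarrow> bool" where
  "ntri_Q C n A \<longleftrightarrow> (\<forall>i j k l. i < j \<and> j < k \<and> k < l \<and> l \<le> n \<longrightarrow>
    cmp C (edge2 A (i, j, l)) (edge1 A (i, k, l)) = cmp C (edge1 A (j, k, l)) (edge2 A (i, j, k)) \<and>
    cmp C (edge3 A (i, k, l)) (edge2 A (j, k, l)) =
      cmp C (shM C (edge1 A (i, j, k))) (edge3 A (i, j, l)))"

definition ntriangles :: "('o, 'm, 'x) shift_category_scheme \<Rightarrow> nat \<Rightarrow> ('o, 'm) ntri set" where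
  "ntriangles C n = {A. ntri_typed C n A \<and> ntri_S C n A \<and> ntri_Q C n A}"

definition ntri_maps :: "('o, 'm, 'x) shift_category_scheme \<Rightarrow> nat \<Rightarrow>
    ('o, 'm) ntri \<Rightarrow> ('o, 'm) ntri \<Rightarrow> (nat \<times> nat \<Rightarrow> 'm) set" where
  "ntri_maps C n A B = {\<phi> \<in> extensional (I2 n).
    (\<forall>p \<in> I2 n. \<phi> p \<in> Hom C (vert A p) (vert B p)) \<and>
    (\<forall>i j k. i < j \<and> j < k \<and> k \<le> n \<longrightarrow>
      cmp C (\<phi> (i, k)) (edge1 A (i, j, k)) = cmp C (edge1 B (i, j, k)) (\<phi> (i, j)) \<and>
      cmp C (\<phi> (j, k)) (edge2 A (i, j, k)) = cmp C (edge2 B (i, j, k)) (\<phi> (i, k)) \<and>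
      cmp C (shM C (\<phi> (i, j))) (edge3 A (i, j, k)) = cmp C (edge3 B (i, j, k)) (\<phi> (j, k)))}"

text \<open>The arrows of the category of \<open>n\<close>-triangles carry their source and target.\<close>

type_synonym ('o, 'm) ntri_arrow = "('o, 'm) ntri \<times> (nat \<times> nat \<Rightarrow> 'm) \<times> ('o, 'm) ntri"

definition ntri_cat :: "('o, 'm, 'x) shift_category_scheme \<Rightarrow> nat \<Rightarrow>
    (('o, 'm) ntri, ('o, 'm) ntri_arrow) category" where
  "ntri_cat C n = \<lparr>
    ob = ntriangles C n,
    ar = {(A, \<phi>, B). A \<in> ntriangles C n \<and> B \<in> ntriangles C n \<and> \<phi> \<in> ntri_maps C n A B},
    src = (\<lambda>(A, \<phi>, B). A),
    trg = (\<lambda>(A, \<phi>, B). B),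
    cmp = (\<lambda>(B, \<psi>, D) (A, \<phi>, B'). (A, \<lambda>p\<in>I2 n. cmp C (\<psi> p) (\<phi> p), D)),
    idt = (\<lambda>A. (A, \<lambda>p\<in>I2 n. idt C (vert A p), A))\<rparr>"

definition triangle2 :: "('o, 'm, 'x) category_scheme \<Rightarrow> 'm \<Rightarrow> 'm \<Rightarrow> 'm \<Rightarrow> ('o, 'm) ntri" where
  "triangle2 C u v w = \<lparr>
    vert = (\<lambda>p\<in>I2 2. if p = (0, 1) then src C u else if p = (0, 2) then trg C u else trg C v),
    edge1 = (\<lambda>p\<in>I3 2. u),
    edge2 = (\<lambda>p\<in>I3 2. v),
    edge3 = (\<lambda>p\<in>I3 2. w)\<rparr>"

definition tri_map2 :: "'m \<Rightarrow> 'm \<Rightarrow> 'm \<Rightarrow> nat \<times> nat \<Rightarrow> 'm" where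
  "tri_map2 f g h = (\<lambda>p\<in>I2 2. if p = (0, 1) then f else if p = (0, 2) then g else h)"


section \<open>Faces, degeneracies, rotations and bases\<close>

definition skip :: "nat \<Rightarrow> nat \<Rightarrow> nat" where
  "skip m i = (if i < m then i else i + 1)"

definition face_ob :: "nat \<Rightarrow> nat \<Rightarrow> ('o, 'm) ntri \<Rightarrow> ('o, 'm) ntri" where
  "face_ob n m A = \<lparr>
    vert = (\<lambda>(i, j)\<in>I2 (n - 1). vert A (skip m i, skip m j)),
    edge1 = (\<lambda>(i, j, k)\<in>I3 (n - 1). edge1 A (skip m i, skip m j, skip m k)),
    edge2 = (\<lambda>(i, j, k)\<in>I3 (n - 1). edge2 A (skip m i, skip m j, skip m k)),
    edge3 = (\<lambda>(i, j, k)\<in>I3 (n - 1). edge3 A (skip m i, skip m j, skip m k))\<rparr>"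

definition face_ar :: "nat \<Rightarrow> nat \<Rightarrow> ('o, 'm) ntri_arrow \<Rightarrow> ('o, 'm) ntri_arrow" where
  "face_ar n m = (\<lambda>(A, \<phi>, B).
    (face_ob n m A, \<lambda>(i, j)\<in>I2 (n - 1). \<phi> (skip m i, skip m j), face_ob n m B))"

definition rept :: "nat \<Rightarrow> nat \<Rightarrow> nat" where
  "rept m i = (if i \<le> m then i else i - 1)"

definition degen_vert :: "('o, 'm, 'x) category_scheme \<Rightarrow> nat \<Rightarrow> ('o, 'm) ntri \<Rightarrow>
    nat \<times> nat \<Rightarrow> 'o" where
  "degen_vert C m A = (\<lambda>(i, j).
    if rept m i = rept m j then zero_ob C else vert A (rept m i, rept m j))"

text \<open>
  \<open>degen_ob C n m\<close> sends \<open>(n - 1)\<close>-triangles to families indexed like \<open>n\<close>-triangles.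
  The result satisfies (Q) only if certain composites of edges (such as \<open>v u\<close>, \<open>w v\<close>,
  \<open>u[1] w\<close> in a \<open>2\<close>-triangle) vanish; for distinguished triangles this is part of
  what the face and degeneracy axiom below demands.
\<close>

definition degen_ob :: "('o, 'm, 'x) shift_category_scheme \<Rightarrow> nat \<Rightarrow> nat \<Rightarrow>
    ('o, 'm) ntri \<Rightarrow> ('o, 'm) ntri" where
  "degen_ob C n m A = \<lparr>
    vert = restrict (degen_vert C m A) (I2 n),
    edge1 = (\<lambda>(i, j, k)\<in>I3 n.
      if rept m i = rept m j then zero_ar C (degen_vert C m A (i, j)) (degen_vert C m A (i, k))
      else if rept m j = rept m k then idt C (degen_vert C m A (i, j))
      else edge1 A (rept m i, rept m j, rept m k)),
    edge2 = (\<lambda>(i, j, k)\<in>I3 n.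
      if rept m i = rept m j then idt C (degen_vert C m A (i, k))
      else if rept m j = rept m k then zero_ar C (degen_vert C m A (i, k)) (degen_vert C m A (j, k))
      else edge2 A (rept m i, rept m j, rept m k)),
    edge3 = (\<lambda>(i, j, k)\<in>I3 n.
      if rept m i = rept m j \<or> rept m j = rept m k
      then zero_ar C (degen_vert C m A (j, k)) (shO C (degen_vert C m A (i, j)))
      else edge3 A (rept m i, rept m j, rept m k))\<rparr>"

definition degen_ar :: "('o, 'm, 'x) shift_category_scheme \<Rightarrow> nat \<Rightarrow> nat \<Rightarrow>
    ('o, 'm) ntri_arrow \<Rightarrow> ('o, 'm) ntri_arrow" where
  "degen_ar C n m = (\<lambda>(A, \<phi>, B).
    (degen_ob C n m A,
     \<lambda>(i, j)\<in>I2 n. if rept m i = rept m j then idt C (zero_ob C) else \<phi> (rept m i, rept m j),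
     degen_ob C n m B))"

definition rot_tau :: "('o, 'm, 'x) shift_category_scheme \<Rightarrow> nat \<Rightarrow>
    ('o, 'm) ntri \<Rightarrow> ('o, 'm) ntri" where
  "rot_tau C n A = \<lparr>
    vert = (\<lambda>(i, j)\<in>I2 n.
      if i = 0 then vert A (j - 1, n) else shO C (vert A (i - 1, j - 1))),
    edge1 = (\<lambda>(i, j, k)\<in>I3 n.
      if i = 0 then edge2 A (j - 1, k - 1, n) else shM C (edge1 A (i - 1, j - 1, k - 1))),
    edge2 = (\<lambda>(i, j, k)\<in>I3 n.
      if i = 0 then edge3 A (j - 1, k - 1, n) else shM C (edge2 A (i - 1, j - 1, k - 1))),
    edge3 = (\<lambda>(i, j, k)\<in>I3 n.
      neg_ar C (shM C (if i = 0 then edge1 A (j - 1, k - 1, n)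
        else edge3 A (i - 1, j - 1, k - 1))))\<rparr>"

definition rot_sigma :: "('o, 'm, 'x) shift_category_scheme \<Rightarrow> nat \<Rightarrow>
    ('o, 'm) ntri \<Rightarrow> ('o, 'm) ntri" where
  "rot_sigma C n A = \<lparr>
    vert = (\<lambda>p\<in>I2 n. shO C (vert A p)),
    edge1 = (\<lambda>p\<in>I3 n. shM C (edge1 A p)),
    edge2 = (\<lambda>p\<in>I3 n. shM C (edge2 A p)),
    edge3 = (\<lambda>p\<in>I3 n. neg_ar C (shM C (edge3 A p)))\<rparr>"

text \<open>
  A simplex diagram on \<open>x\<^sub>1 \<rightarrow> \<dots> \<rightarrow> x\<^sub>n\<close> comprises all morphisms \<open>x\<^sub>i \<rightarrow> x\<^sub>j\<close> with \<open>i < j\<close>.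
\<close>

record ('o, 'm) simplex =
  sob :: "nat \<Rightarrow> 'o"
  sar :: "nat \<times> nat \<Rightarrow> 'm"

definition chain_pairs :: "nat \<Rightarrow> (nat \<times> nat) set" where
  "chain_pairs n = {(i, j). 1 \<le> i \<and> i < j \<and> j \<le> n}"

definition simplices :: "('o, 'm, 'x) category_scheme \<Rightarrow> nat \<Rightarrow> ('o, 'm) simplex set" where
  "simplices C n = {X.
    sob X \<in> {1..n} \<rightarrow>\<^sub>E ob C \<and> sar X \<in> extensional (chain_pairs n) \<and>
    (\<forall>(i, j) \<in> chain_pairs n. sar X (i, j) \<in> Hom C (sob X i) (sob X j)) \<and>
    (\<forall>i j k. 1 \<le> i \<and> i < j \<and> j < k \<and> k \<le> n \<longrightarrow>
      cmp C (sar X (j, k)) (sar X (i, j)) = sar X (i, k))}"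

definition simplex_maps :: "('o, 'm, 'x) category_scheme \<Rightarrow> nat \<Rightarrow>
    ('o, 'm) simplex \<Rightarrow> ('o, 'm) simplex \<Rightarrow> (nat \<Rightarrow> 'm) set" where
  "simplex_maps C n X Y = {\<psi> \<in> extensional {1..n}.
    (\<forall>i \<in> {1..n}. \<psi> i \<in> Hom C (sob X i) (sob Y i)) \<and>
    (\<forall>(i, j) \<in> chain_pairs n. cmp C (\<psi> j) (sar X (i, j)) = cmp C (sar Y (i, j)) (\<psi> i))}"

definition base :: "nat \<Rightarrow> ('o, 'm) ntri \<Rightarrow> ('o, 'm) simplex" where
  "base n A = \<lparr>
    sob = (\<lambda>j\<in>{1..n}. vert A (0, j)),
    sar = (\<lambda>(j, k)\<in>chain_pairs n. edge1 A (0, j, k))\<rparr>"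


section \<open>Fully triangulated categories\<close>

text \<open>\<open>DO n\<close> and \<open>DA n\<close> are the objects and the arrows of the subcategory \<open>D\<^sub>n\<close>.\<close>

locale fully_triangulated =
  shift_category C for C :: "('o, 'm, 'x) shift_category_scheme" (structure) +
  fixes DO :: "nat \<Rightarrow> ('o, 'm) ntri set"
    and DA :: "nat \<Rightarrow> ('o, 'm) ntri_arrow set"
  assumes dist_subcategory: "n \<ge> 2 \<Longrightarrow> subcategory (ntri_cat C n) (DO n) (DA n)"
    and iso_dist_arrow: "\<lbrakk>n \<ge> 2; iso_arrow (ntri_cat C n) (A, \<phi>, B); A \<in> DO n; B \<in> DO n\<rbrakk>
      \<Longrightarrow> (A, \<phi>, B) \<in> DA n"
    and iso_dist_object: "\<lbrakk>n \<ge> 2; iso_arrow (ntri_cat C n) (A, \<phi>, B); A \<in> DO n\<rbrakk> \<Longrightarrow> B \<in> DO n"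
    and rotation_tau: "\<lbrakk>n \<ge> 2; A \<in> DO n\<rbrakk> \<Longrightarrow> rot_tau C n A \<in> DO n"
    and rotation_sigma: "\<lbrakk>n \<ge> 2; A \<in> DO n\<rbrakk> \<Longrightarrow> rot_sigma C n A \<in> DO n"
    and faces: "\<lbrakk>n > 2; m \<le> n; F \<in> DA n\<rbrakk> \<Longrightarrow> face_ar n m F \<in> DA (n - 1)"
    and degeneracies: "\<lbrakk>n > 2; m \<le> n - 1; F \<in> DA (n - 1)\<rbrakk> \<Longrightarrow> degen_ar C n m F \<in> DA n"
    and base_object: "\<lbrakk>n \<ge> 2; X \<in> simplices C n\<rbrakk> \<Longrightarrow> \<exists>A \<in> DO n. base n A = X"
    and base_map: "\<lbrakk>n \<ge> 2; A \<in> DO n; B \<in> DO n; base n A = X; base n B = Y;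
        \<psi> \<in> simplex_maps C n X Y\<rbrakk>
      \<Longrightarrow> \<exists>\<phi>. (A, \<phi>, B) \<in> DA n \<and> (\<forall>j \<in> {1..n}. \<phi> (0, j) = \<psi> j)"
    and lightning_strike: "\<lbrakk>(triangle2 C u v w, tri_map2 f g h, triangle2 C u' v' w') \<in> DA 2;
        (triangle2 C u v w, tri_map2 f g h', triangle2 C u' v' w') \<in> DA 2\<rbrakk>
      \<Longrightarrow> \<exists>\<theta> \<in> Hom C (shO C (src C u)) (trg C u'). h' \<oplus> neg_ar C h = v' \<cdot> \<theta> \<cdot> w"

end

theory Submission
  imports Defs
begin

text \<open>
  The idea is to route the given square through a third triangle on which the perturbation
  becomes an automorphism. In a distinguished triangle \<open>(u, v, w)\<close> the composite \<open>w v\<close> vanishes,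
  because degenerating the triangle yields a \<open>3\<close>-triangle one of whose commuting squares says
  just that. Hence for \<open>\<theta> : a[1] \<rightarrow> b\<close> the endomorphism \<open>v \<theta> w\<close> of \<open>c\<close> has square zero and
  \<open>(1, 1, 1 + v \<theta> w)\<close> is an automorphism of the triangle. Isomorphisms between distinguished
  triangles are distinguished, so this settles the case of the identity map
  (\<open>dist_automorphism\<close>).

  For a commuting square \<open>g u = u' f\<close>, choose a distinguished triangle \<open>(g u, s, t)\<close>
  on the diagonal \<open>a \<rightarrow> b'\<close>. The square factors through it as \<open>(1, g)\<close> followed by \<open>(f, 1)\<close>, and
  both factors extend to distinguished maps, with third components \<open>i\<close> and \<open>q\<close>. The triangle on
  the diagonal starts at \<open>a\<close> and has \<open>b'\<close> as its second object, so every \<open>\<theta> : a[1] \<rightarrow> b'\<close> gives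
  an automorphism of it. Composing the three maps gives
  \<open>q (1 + s \<theta> t) i = q i + v' \<theta> w\<close>, since \<open>q s = v'\<close> and \<open>t i = w\<close>. Thus \<open>(f, g, q i + v' \<theta> w)\<close> is
  distinguished for every \<open>\<theta>\<close> (\<open>dist_map_translates\<close>).

  The third component \<open>h\<close> that is given need not equal \<open>q i\<close>, but lightning strike says
  that it differs from \<open>q i\<close> by some \<open>v' \<eta> w\<close>; so \<open>h + v' \<theta> w = q i + v' (\<eta> + \<theta>) w\<close> is again a third
  component of the form just obtained.
\<close>

section \<open>Additive arithmetic of morphisms\<close>

lemma (in category) Hom_ob:
  assumes "f \<in> Hom C a b"
  shows "a \<in> ob C" "b \<in> ob C"
  using assms src_ob trg_ob by (auto simp: Hom_def)

context additive_category
begin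

lemma plus_Hom: "\<lbrakk>f \<in> Hom C a b; g \<in> Hom C a b\<rbrakk> \<Longrightarrow> f \<oplus> g \<in> Hom C a b"
  using comm_group.axioms(2)[OF hom_comm_group, of a b] Hom_ob[of f a b]
    monoid.m_closed[of "hom_group C a b" f g]
  by (simp add: hom_group_def group_def)

lemma plus_assoc:
  "\<lbrakk>f \<in> Hom C a b; g \<in> Hom C a b; h \<in> Hom C a b\<rbrakk> \<Longrightarrow> (f \<oplus> g) \<oplus> h = f \<oplus> (g \<oplus> h)"
  using comm_group.axioms(2)[OF hom_comm_group, of a b] Hom_ob[of f a b]
    monoid.m_assoc[of "hom_group C a b" f g h]
  by (simp add: hom_group_def group_def)

lemma plus_commute: "\<lbrakk>f \<in> Hom C a b; g \<in> Hom C a b\<rbrakk> \<Longrightarrow> f \<oplus> g = g \<oplus> f"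
  using hom_comm_group[of a b] Hom_ob[of f a b] comm_monoid.m_comm[of "hom_group C a b" f g]
  by (simp add: hom_group_def comm_group_def)

lemma zero_Hom: "\<lbrakk>a \<in> ob C; b \<in> ob C\<rbrakk> \<Longrightarrow> zero_ar C a b \<in> Hom C a b"
  using comm_group.axioms(2)[OF hom_comm_group, of a b] monoid.one_closed[of "hom_group C a b"]
  by (simp add: hom_group_def group_def)

lemma plus_zero: "f \<in> Hom C a b \<Longrightarrow> f \<oplus> zero_ar C a b = f"
  using comm_group.axioms(2)[OF hom_comm_group, of a b] Hom_ob[of f a b]
    monoid.r_one[of "hom_group C a b" f]
  by (simp add: hom_group_def group_def)

lemma neg_Hom: "f \<in> Hom C a b \<Longrightarrow> neg_ar C f \<in> Hom C a b"
  using comm_group.axioms(2)[OF hom_comm_group, of a b] Hom_ob[of f a b]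
    group.inv_closed[of "hom_group C a b" f]
  by (simp add: neg_ar_def hom_group_def Hom_def)

lemma plus_neg: "f \<in> Hom C a b \<Longrightarrow> f \<oplus> neg_ar C f = zero_ar C a b"
  using comm_group.axioms(2)[OF hom_comm_group, of a b] Hom_ob[of f a b]
    group.r_inv[of "hom_group C a b" f]
  by (simp add: neg_ar_def hom_group_def Hom_def)

lemma neg_plus: "f \<in> Hom C a b \<Longrightarrow> neg_ar C f \<oplus> f = zero_ar C a b"
  using plus_neg plus_commute neg_Hom by metis

lemma plus_idem_zero:
  assumes f: "f \<in> Hom C a b" and "f \<oplus> f = f"
  shows "f = zero_ar C a b"
  using plus_assoc[OF f f neg_Hom[OF f]] plus_neg[OF f] plus_zero[OF f] assms(2) by simp

lemma cmp_zero:
  assumes g: "g \<in> Hom C b c" and a: "a \<in> ob C"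
  shows "g \<cdot> zero_ar C a b = zero_ar C a c"
proof -
  have z: "zero_ar C a b \<in> Hom C a b"
    using zero_Hom a Hom_ob[OF g] by blast
  show ?thesis
    using cmp_plus_right[OF z z g] plus_zero[OF z] plus_idem_zero[OF cmp_Hom[OF z g]] by simp
qed

lemma zero_cmp:
  assumes f: "f \<in> Hom C a b" and c: "c \<in> ob C"
  shows "zero_ar C b c \<cdot> f = zero_ar C a c"
proof -
  have z: "zero_ar C b c \<in> Hom C b c"
    using zero_Hom c Hom_ob[OF f] by blast
  show ?thesis
    using cmp_plus_left[OF f z z] plus_zero[OF z] plus_idem_zero[OF cmp_Hom[OF f z]] by simp
qed

text \<open>For \<open>e\<close> of square zero and \<open>e' = - e\<close> this makes \<open>1 + e\<close> invertible.\<close>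

lemma id_plus_cmp:
  assumes e: "e \<in> Hom C a a" and e': "e' \<in> Hom C a a" and z: "e' \<cdot> e = zero_ar C a a"
  shows "(idt C a \<oplus> e') \<cdot> (idt C a \<oplus> e) = idt C a \<oplus> (e' \<oplus> e)"
proof -
  have i: "idt C a \<in> Hom C a a"
    using idt_Hom Hom_ob[OF e] by blast
  have "(idt C a \<oplus> e') \<cdot> (idt C a \<oplus> e) = (idt C a \<oplus> e) \<oplus> (e' \<oplus> zero_ar C a a)"
    using z by (simp add: cmp_plus_left[OF plus_Hom[OF i e] i e'] idt_cmp[OF plus_Hom[OF i e]]
        cmp_plus_right[OF i e e'] cmp_idt[OF e'])
  also have "\<dots> = idt C a \<oplus> (e' \<oplus> e)"
    using plus_zero[OF e'] plus_assoc[OF i e e'] plus_commute[OF e e'] by simp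
  finally show ?thesis .
qed

end

section \<open>The category of two-triangles in coordinates\<close>

lemma I2_2: "I2 2 = {(0, 1), (0, 2), (1, 2)}"
  by (auto simp: I2_def)

lemma I3_2: "I3 2 = {(0, 1, 2)}"
  by (auto simp: I3_def)

lemma index3_le_2: "(i < j \<and> j < k \<and> k \<le> (2::nat)) \<longleftrightarrow> i = 0 \<and> j = 1 \<and> k = 2"
  by auto

lemma chain_pairs_2: "chain_pairs 2 = {(1, 2)}"
  by (auto simp: chain_pairs_def)

context shift_category
begin

lemma triangle2_ntriangles:
  assumes "u \<in> Hom C a b" "v \<in> Hom C b c" "w \<in> Hom C c (shO C a)"
  shows "triangle2 C u v w \<in> ntriangles C 2"
proof -
  have "ntri_typed C 2 (triangle2 C u v w)"
    using assms Hom_ob[OF assms(1)] Hom_ob[OF assms(2)]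
    unfolding ntri_typed_def index3_le_2
    by (auto simp: triangle2_def I2_2 I3_2 Hom_def)
  \<comment> \<open>Conditions (S) and (Q) speak of four distinct indices, and a \<open>2\<close>-triangle has three.\<close>
  then show ?thesis
    by (auto simp: ntriangles_def ntri_S_def ntri_Q_def)
qed

lemma ntriangles2_cases:
  assumes "A \<in> ntriangles C 2"
  obtains a b c u v w where "A = triangle2 C u v w"
    "u \<in> Hom C a b" "v \<in> Hom C b c" "w \<in> Hom C c (shO C a)"
proof -
  let ?u = "edge1 A (0, 1, 2)" and ?v = "edge2 A (0, 1, 2)" and ?w = "edge3 A (0, 1, 2)"
  have ty: "vert A \<in> extensional (I2 2)" "edge1 A \<in> extensional (I3 2)"
      "edge2 A \<in> extensional (I3 2)" "edge3 A \<in> extensional (I3 2)"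
    and h: "?u \<in> Hom C (vert A (0, 1)) (vert A (0, 2))"
      "?v \<in> Hom C (vert A (0, 2)) (vert A (1, 2))"
      "?w \<in> Hom C (vert A (1, 2)) (shO C (vert A (0, 1)))"
    using assms unfolding ntriangles_def ntri_typed_def index3_le_2 by (auto simp: PiE_def)
  have "A = triangle2 C ?u ?v ?w"
  proof (rule ntri.equality)
    show "vert A = vert (triangle2 C ?u ?v ?w)"
      using h by (intro extensionalityI[OF ty(1)]) (auto simp: triangle2_def I2_2 Hom_def)
  qed (use ty in \<open>auto intro!: extensionalityI simp: triangle2_def I3_2\<close>)
  then show thesis
    using h that by blast
qed

lemma ntri_maps2_tri_map2:
  assumes "\<phi> \<in> ntri_maps C 2 A B"
  shows "\<phi> = tri_map2 (\<phi> (0, 1)) (\<phi> (0, 2)) (\<phi> (1, 2))"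
proof (rule extensionalityI)
  show "\<phi> \<in> extensional (I2 2)"
    using assms by (simp add: ntri_maps_def)
qed (auto simp: tri_map2_def I2_2)

lemma tri_map2_arrow_iff:
  assumes X: "u \<in> Hom C a b" "v \<in> Hom C b c" "w \<in> Hom C c (shO C a)"
    and X': "u' \<in> Hom C a' b'" "v' \<in> Hom C b' c'" "w' \<in> Hom C c' (shO C a')"
  shows "(triangle2 C u v w, tri_map2 f g h, triangle2 C u' v' w') \<in> ar (ntri_cat C 2) \<longleftrightarrow>
    f \<in> Hom C a a' \<and> g \<in> Hom C b b' \<and> h \<in> Hom C c c' \<and>
    g \<cdot> u = u' \<cdot> f \<and> h \<cdot> v = v' \<cdot> g \<and> shM C f \<cdot> w = w' \<cdot> h"
  using triangle2_ntriangles[OF X] triangle2_ntriangles[OF X'] X X'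
  unfolding ntri_cat_def ntri_maps_def index3_le_2
  by (simp add: triangle2_def tri_map2_def I2_2 I3_2) (auto simp: Hom_def)

lemma cmp_tri_map2:
  "cmp (ntri_cat C 2) (B, tri_map2 f' g' h', D) (A, tri_map2 f g h, B') =
    (A, tri_map2 (f' \<cdot> f) (g' \<cdot> g) (h' \<cdot> h), D)"
  by (auto simp: ntri_cat_def tri_map2_def I2_2 restrict_def)

lemma idt_tri_map2:
  assumes "u \<in> Hom C a b" "v \<in> Hom C b c"
  shows "idt (ntri_cat C 2) (triangle2 C u v w) =
    (triangle2 C u v w, tri_map2 (idt C a) (idt C b) (idt C c), triangle2 C u v w)"
  using assms by (auto simp: ntri_cat_def tri_map2_def triangle2_def I2_2 Hom_def restrict_def)

end

section \<open>Distinguished maps\<close>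

context fully_triangulated
begin

lemma dist_ntriangles: "\<lbrakk>n \<ge> 2; A \<in> DO n\<rbrakk> \<Longrightarrow> A \<in> ntriangles C n"
  using dist_subcategory[of n] by (auto simp: subcategory_def ntri_cat_def)

lemma dist_arrow:
  assumes "n \<ge> 2" "(A, \<phi>, B) \<in> DA n"
  shows "(A, \<phi>, B) \<in> ar (ntri_cat C n)" "A \<in> DO n" "B \<in> DO n"
  using dist_subcategory[OF assms(1)] assms(2) by (auto simp: subcategory_def ntri_cat_def)

lemma dist_cmp2:
  assumes "(A, tri_map2 f g h, B) \<in> DA 2" "(B, tri_map2 f' g' h', D) \<in> DA 2"
  shows "(A, tri_map2 (f' \<cdot> f) (g' \<cdot> g) (h' \<cdot> h), D) \<in> DA 2"
proof -
  have "cmp (ntri_cat C 2) (B, tri_map2 f' g' h', D) (A, tri_map2 f g h, B) \<in> DA 2"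
    using dist_subcategory[of 2] assms unfolding subcategory_def
    by (auto simp: ntri_cat_def)
  then show ?thesis
    by (simp add: cmp_tri_map2)
qed

text \<open>
  Repeating the index \<open>0\<close> gives a \<open>3\<close>-triangle whose indices \<open>0, 1, 2, 3\<close> come from \<open>0, 0, 1, 2\<close>.
  Since \<open>a\<^sub>0\<^sub>1\<close> is then the zero object, the square of condition (Q) from \<open>a\<^sub>1\<^sub>3 = b\<close> to
  \<open>a\<^sub>0\<^sub>2[1] = a[1]\<close> equates the composite \<open>w v\<close> with a map through \<open>0[1]\<close>.
\<close>

lemma dist_triangle_wv_zero:
  assumes D: "triangle2 C u v w \<in> DO 2"
    and u: "u \<in> Hom C a b" and v: "v \<in> Hom C b c" and w: "w \<in> Hom C c (shO C a)"
  shows "w \<cdot> v = zero_ar C b (shO C a)"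
proof -
  let ?A = "triangle2 C u v w" and ?B = "degen_ob C 3 0 (triangle2 C u v w)"
  \<comment> \<open>The degeneracy axiom concerns maps; applied to an identity it gives a statement on objects.\<close>
  have "idt (ntri_cat C 2) ?A \<in> DA 2"
    using dist_subcategory[of 2] D by (auto simp: subcategory_def)
  then have "degen_ar C 3 0 (idt (ntri_cat C 2) ?A) \<in> DA 3"
    using degeneracies[of 3 0] by simp
  then have "?B \<in> DO 3"
    using dist_arrow(2)[of 3] by (auto simp: degen_ar_def ntri_cat_def)
  then have B: "ntri_typed C 3 ?B" "ntri_Q C 3 ?B"
    using dist_ntriangles[of 3] by (auto simp: ntriangles_def)
  have vert: "vert ?B (0, 1) = zero_ob C" "vert ?B (0, 2) = a"
    using u by (auto simp: degen_ob_def degen_vert_def rept_def I2_def triangle2_def Hom_def)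
  have edges: "edge2 ?B (1, 2, 3) = v" "edge3 ?B (0, 2, 3) = w"
    "edge3 ?B (0, 1, 3) = zero_ar C b (shO C (zero_ob C))"
    using u by (auto simp: degen_ob_def degen_vert_def rept_def I2_def I3_def triangle2_def Hom_def)
  have typed: "edge1 ?B (i, j, k) \<in> Hom C (vert ?B (i, j)) (vert ?B (i, k))"
    if "i < j" "j < k" "k \<le> 3" for i j k
    using B(1) that by (simp add: ntri_typed_def)
  have square: "edge3 ?B (i, k, l) \<cdot> edge2 ?B (j, k, l) = shM C (edge1 ?B (i, j, k)) \<cdot> edge3 ?B (i, j, l)"
    if "i < j" "j < k" "k < l" "l \<le> 3" for i j k l
    using B(2) that by (simp add: ntri_Q_def)
  have "edge1 ?B (0, 1, 2) \<in> Hom C (zero_ob C) a"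
    using vert typed[of 0 1 2] by simp
  then have "shM C (edge1 ?B (0, 1, 2)) \<in> Hom C (shO C (zero_ob C)) (shO C a)"
    by (rule shM_Hom)
  moreover have "w \<cdot> v = shM C (edge1 ?B (0, 1, 2)) \<cdot> zero_ar C b (shO C (zero_ob C))"
    using edges square[of 0 1 2 3] by simp
  ultimately show ?thesis
    using cmp_zero Hom_ob[OF u] by simp
qed

text \<open>
  Both \<open>(v \<theta> w) v\<close> and \<open>w (v \<theta> w)\<close> vanish with \<open>w v\<close>, so adding \<open>v \<theta> w\<close> to the identity of \<open>c\<close>
  preserves the two squares at \<open>c\<close>. As \<open>v \<theta> w\<close> has square zero, replacing \<open>\<theta>\<close> by \<open>- \<theta>\<close> gives the
  inverse, and isomorphisms between distinguished triangles are distinguished.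
\<close>

lemma dist_automorphism:
  assumes D: "triangle2 C u v w \<in> DO 2"
    and u: "u \<in> Hom C a b" and v: "v \<in> Hom C b c" and w: "w \<in> Hom C c (shO C a)"
    and \<theta>: "\<theta> \<in> Hom C (shO C a) b"
  shows "(triangle2 C u v w, tri_map2 (idt C a) (idt C b) (idt C c \<oplus> v \<cdot> \<theta> \<cdot> w),
    triangle2 C u v w) \<in> DA 2"
proof -
  let ?X = "triangle2 C u v w"
  define e where "e t = v \<cdot> t \<cdot> w" for t
  define F where "F t = (?X, tri_map2 (idt C a) (idt C b) (idt C c \<oplus> e t), ?X)" for t
  let ?T = "Hom C (shO C a) b"
  note wv = dist_triangle_wv_zero[OF D u v w]
  note obs = Hom_ob[OF u] Hom_ob[OF w]
  have ia: "idt C a \<in> Hom C a a" and ib: "idt C b \<in> Hom C b b" and ic: "idt C c \<in> Hom C c c"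
    using idt_Hom obs by auto
  have tw: "t \<cdot> w \<in> Hom C c b" and e: "e t \<in> Hom C c c" if "t \<in> ?T" for t
    using that v w cmp_Hom unfolding e_def by blast+
  have ev: "e t \<cdot> v = zero_ar C b c" and we: "w \<cdot> e t = zero_ar C c (shO C a)" if t: "t \<in> ?T" for t
  proof -
    show "e t \<cdot> v = zero_ar C b c"
      using wv cmp_assoc[OF v tw[OF t] v] cmp_assoc[OF v w t] cmp_zero[OF t obs(2)]
        cmp_zero[OF v obs(2)] by (simp add: e_def)
    show "w \<cdot> e t = zero_ar C c (shO C a)"
      using wv cmp_assoc[OF tw[OF t] v w] zero_cmp[OF tw[OF t] obs(4)] by (simp add: e_def)
  qed
  have ee: "e s \<cdot> e t = zero_ar C c c" if s: "s \<in> ?T" and t: "t \<in> ?T" for s t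
    using cmp_assoc[OF tw[OF t] v e[OF s]] ev[OF s] zero_cmp[OF tw[OF t] obs(3)]
    by (simp add: e_def[of t])
  have arr: "F t \<in> ar (ntri_cat C 2)" if t: "t \<in> ?T" for t
    unfolding F_def tri_map2_arrow_iff[OF u v w u v w]
    using ia ib ic u v w e[OF t] ev[OF t] we[OF t] obs
    by (simp add: plus_Hom cmp_plus_left[OF v ic e[OF t]] cmp_plus_right[OF ic e[OF t] w]
        idt_cmp[OF u] idt_cmp[OF v] idt_cmp[OF w] cmp_idt[OF u] cmp_idt[OF v] cmp_idt[OF w]
        plus_zero[OF v] plus_zero[OF w] shM_idt)
  have FF: "cmp (ntri_cat C 2) (F s) (F t) = idt (ntri_cat C 2) ?X"
    if s: "s \<in> ?T" and t: "t \<in> ?T" and st: "s \<oplus> t = zero_ar C (shO C a) b" for s t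
  proof -
    have "e s \<oplus> e t = v \<cdot> (s \<oplus> t) \<cdot> w"
      using cmp_plus_left[OF w s t] cmp_plus_right[OF tw[OF s] tw[OF t] v] by (simp add: e_def)
    also have "\<dots> = zero_ar C c c"
      using st zero_cmp[OF w obs(2)] cmp_zero[OF v obs(3)] by simp
    finally have "(idt C c \<oplus> e s) \<cdot> (idt C c \<oplus> e t) = idt C c"
      using id_plus_cmp[OF e[OF t] e[OF s] ee[OF s t]] plus_zero[OF ic] by simp
    then show ?thesis
      using cmp_idt[OF ia] cmp_idt[OF ib]
      by (simp add: F_def cmp_tri_map2 idt_tri_map2[OF u v])
  qed
  have "iso_arrow (ntri_cat C 2) (F \<theta>)"
    unfolding iso_arrow_def
  proof (intro conjI bexI)
    show "F \<theta> \<in> ar (ntri_cat C 2)"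
      by (rule arr[OF \<theta>])
    show "F (neg_ar C \<theta>) \<in> Hom (ntri_cat C 2) (trg (ntri_cat C 2) (F \<theta>)) (src (ntri_cat C 2) (F \<theta>))"
      using arr[OF neg_Hom[OF \<theta>]] by (auto simp: Hom_def F_def ntri_cat_def)
    show "cmp (ntri_cat C 2) (F (neg_ar C \<theta>)) (F \<theta>) = idt (ntri_cat C 2) (src (ntri_cat C 2) (F \<theta>))"
      using FF[OF neg_Hom[OF \<theta>] \<theta> neg_plus[OF \<theta>]] by (simp add: F_def ntri_cat_def)
    show "cmp (ntri_cat C 2) (F \<theta>) (F (neg_ar C \<theta>)) = idt (ntri_cat C 2) (trg (ntri_cat C 2) (F \<theta>))"
      using FF[OF \<theta> neg_Hom[OF \<theta>] plus_neg[OF \<theta>]] by (simp add: F_def ntri_cat_def)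
  qed
  then show ?thesis
    using iso_dist_arrow[of 2] D by (simp add: F_def e_def)
qed

lemma dist_triangle_on:
  assumes u: "u \<in> Hom C a b"
  obtains c v w where "triangle2 C u v w \<in> DO 2" "v \<in> Hom C b c" "w \<in> Hom C c (shO C a)"
proof -
  define X where "X = \<lparr>sob = (\<lambda>i\<in>{1..2}. if i = 1 then a else b), sar = (\<lambda>p\<in>chain_pairs 2. u)\<rparr>"
  have "X \<in> simplices C 2"
    using u Hom_ob[OF u] by (auto simp: X_def simplices_def chain_pairs_2)
  then obtain A where A: "A \<in> DO 2" "base 2 A = X"
    using base_object[of 2] by blast
  obtain a' b' c u' v w where A': "A = triangle2 C u' v w" "u' \<in> Hom C a' b'"
    "v \<in> Hom C b' c" "w \<in> Hom C c (shO C a')"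
    by (rule ntriangles2_cases[OF dist_ntriangles[OF order_refl A(1)]])
  have "sar (base 2 A) (1, 2) = u'"
    by (simp add: A'(1) base_def chain_pairs_2 triangle2_def I3_2)
  then have "u' = u"
    using A(2) by (simp add: X_def chain_pairs_2)
  moreover from this have "a' = a" "b' = b"
    using A'(2) u by (auto simp: Hom_def)
  ultimately show thesis
    using that A A' by blast
qed

lemma dist_map_extending:
  assumes D: "triangle2 C u v w \<in> DO 2" and D': "triangle2 C u' v' w' \<in> DO 2"
    and u: "u \<in> Hom C a b" and u': "u' \<in> Hom C a' b'"
    and f: "f \<in> Hom C a a'" and g: "g \<in> Hom C b b'" and sq: "g \<cdot> u = u' \<cdot> f"
  obtains h where "(triangle2 C u v w, tri_map2 f g h, triangle2 C u' v' w') \<in> DA 2"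
proof -
  let ?X = "triangle2 C u v w" and ?X' = "triangle2 C u' v' w'"
  define \<psi> where "\<psi> = (\<lambda>i\<in>{1..2::nat}. if i = 1 then f else g)"
  have "\<psi> \<in> simplex_maps C 2 (base 2 ?X) (base 2 ?X')"
    using u u' f g sq
    by (auto simp: \<psi>_def simplex_maps_def base_def chain_pairs_2 triangle2_def I2_2 I3_2 Hom_def)
  then obtain \<phi> where \<phi>: "(?X, \<phi>, ?X') \<in> DA 2" "\<forall>j\<in>{1..2}. \<phi> (0, j) = \<psi> j"
    using base_map[of 2 ?X ?X'] D D' by blast
  then have "\<phi> (0, 1) = f" "\<phi> (0, 2) = g"
    by (auto simp: \<psi>_def)
  moreover have "\<phi> \<in> ntri_maps C 2 ?X ?X'"
    using dist_arrow(1)[OF _ \<phi>(1)] by (auto simp: ntri_cat_def)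
  ultimately have "\<phi> = tri_map2 f g (\<phi> (1, 2))"
    using ntri_maps2_tri_map2 by metis
  then show thesis
    using that \<phi>(1) by metis
qed

text \<open>
  The triangle \<open>(g u, s, t)\<close> on the diagonal of the square has \<open>a\<close> as its first and \<open>b'\<close> as its
  second object, so \<open>\<theta> : a[1] \<rightarrow> b'\<close>, which joins objects of two different triangles, defines an
  automorphism of this one. The witness is \<open>k = q i\<close>, where \<open>i\<close> and \<open>q\<close> are the third components
  of distinguished maps into and out of that triangle; it is chosen before \<open>\<theta>\<close>.
\<close>

lemma dist_map_translates:
  assumes D: "triangle2 C u v w \<in> DO 2" and D': "triangle2 C u' v' w' \<in> DO 2"
    and u: "u \<in> Hom C a b" and v: "v \<in> Hom C b c" and w: "w \<in> Hom C c (shO C a)"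
    and u': "u' \<in> Hom C a' b'" and v': "v' \<in> Hom C b' c'" and w': "w' \<in> Hom C c' (shO C a')"
    and f: "f \<in> Hom C a a'" and g: "g \<in> Hom C b b'" and sq: "g \<cdot> u = u' \<cdot> f"
  obtains k where "k \<in> Hom C c c'"
    "\<And>\<theta>. \<theta> \<in> Hom C (shO C a) b' \<Longrightarrow>
      (triangle2 C u v w, tri_map2 f g (k \<oplus> v' \<cdot> \<theta> \<cdot> w), triangle2 C u' v' w') \<in> DA 2"
proof -
  let ?X = "triangle2 C u v w" and ?X' = "triangle2 C u' v' w'"
  have gu: "g \<cdot> u \<in> Hom C a b'"
    by (rule cmp_Hom[OF u g])
  obtain y s t where Y: "triangle2 C (g \<cdot> u) s t \<in> DO 2"
    and s: "s \<in> Hom C b' y" and t: "t \<in> Hom C y (shO C a)"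
    by (rule dist_triangle_on[OF gu])
  let ?Y = "triangle2 C (g \<cdot> u) s t"
  have ia: "idt C a \<in> Hom C a a" and ib: "idt C b' \<in> Hom C b' b'" and iy: "idt C y \<in> Hom C y y"
    using idt_Hom Hom_ob[OF gu] Hom_ob[OF s] by auto
  obtain i where I: "(?X, tri_map2 (idt C a) g i, ?Y) \<in> DA 2"
    using dist_map_extending[OF D Y u gu ia g] cmp_idt[OF gu] by auto
  obtain q where Q: "(?Y, tri_map2 f (idt C b') q, ?X') \<in> DA 2"
    using dist_map_extending[OF Y D' gu u' f ib] idt_cmp[OF gu] sq by auto
  have i: "i \<in> Hom C c y" and ti: "t \<cdot> i = w"
    using dist_arrow(1)[OF _ I] idt_cmp[OF w] Hom_ob[OF u]
    by (auto simp: tri_map2_arrow_iff[OF u v w gu s t] shM_idt)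
  have q: "q \<in> Hom C y c'" and qs: "q \<cdot> s = v'"
    using dist_arrow(1)[OF _ Q] cmp_idt[OF v']
    by (auto simp: tri_map2_arrow_iff[OF gu s t u' v' w'])
  have "(?X, tri_map2 f g (q \<cdot> i \<oplus> v' \<cdot> \<theta> \<cdot> w), ?X') \<in> DA 2"
    if \<theta>: "\<theta> \<in> Hom C (shO C a) b'" for \<theta>
  proof -
    have \<theta>t: "\<theta> \<cdot> t \<in> Hom C y b'" and \<theta>w: "\<theta> \<cdot> w \<in> Hom C c b'"
      using cmp_Hom t w \<theta> by blast+
    have st: "s \<cdot> \<theta> \<cdot> t \<in> Hom C y y"
      by (rule cmp_Hom[OF \<theta>t s])
    have "(s \<cdot> \<theta> \<cdot> t) \<cdot> i = s \<cdot> \<theta> \<cdot> w"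
      using cmp_assoc[OF i \<theta>t s] cmp_assoc[OF i t \<theta>] ti by simp
    then have "q \<cdot> (idt C y \<oplus> s \<cdot> \<theta> \<cdot> t) \<cdot> i = q \<cdot> (i \<oplus> s \<cdot> \<theta> \<cdot> w)"
      using cmp_plus_left[OF i iy st] idt_cmp[OF i] by simp
    also have "\<dots> = q \<cdot> i \<oplus> v' \<cdot> \<theta> \<cdot> w"
      using cmp_plus_right[OF i cmp_Hom[OF \<theta>w s] q] cmp_assoc[OF \<theta>w s q] qs by simp
    finally show ?thesis
      using dist_cmp2[OF dist_cmp2[OF I dist_automorphism[OF Y gu s t \<theta>]] Q]
        cmp_idt[OF f] cmp_idt[OF ia] idt_cmp[OF g] by simp
  qed
  then show thesis
    using that cmp_Hom[OF i q] by blast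
qed

end

theorem proposition4p10:
  fixes C :: "('o, 'm, 'x) shift_category_scheme" (structure)
    and DO :: "nat \<Rightarrow> ('o, 'm) ntri set"
    and DA :: "nat \<Rightarrow> ('o, 'm) ntri_arrow set"
    and a b c a' b' c' :: 'o
    and u v w u' v' w' f g h \<theta> :: 'm
  assumes "fully_triangulated C DO DA"
    and "u \<in> Hom C a b" and "v \<in> Hom C b c" and "w \<in> Hom C c (shO C a)"
    and "u' \<in> Hom C a' b'" and "v' \<in> Hom C b' c'" and "w' \<in> Hom C c' (shO C a')"
    and "(triangle2 C u v w, tri_map2 f g h, triangle2 C u' v' w') \<in> DA 2"
    and "\<theta> \<in> Hom C (shO C a) b'"
  shows "(triangle2 C u v w, tri_map2 f g (h \<oplus> v' \<cdot> \<theta> \<cdot> w), triangle2 C u' v' w') \<in> DA 2"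
proof -
  interpret fully_triangulated C DO DA
    by (rule assms(1))
  note X = assms(2-4) and X' = assms(5-7) and fgh = assms(8) and \<theta> = assms(9)
  note v' = X'(2) and w = X(3)
  have map: "f \<in> Hom C a a'" "g \<in> Hom C b b'" "h \<in> Hom C c c'" "g \<cdot> u = u' \<cdot> f"
    using dist_arrow(1)[OF _ fgh] tri_map2_arrow_iff[OF X X'] by auto
  obtain k where k: "k \<in> Hom C c c'"
    and dist: "\<And>\<theta>. \<theta> \<in> Hom C (shO C a) b' \<Longrightarrow>
      (triangle2 C u v w, tri_map2 f g (k \<oplus> v' \<cdot> \<theta> \<cdot> w), triangle2 C u' v' w') \<in> DA 2"
    using dist_map_translates[OF dist_arrow(2,3)[OF _ fgh] X X' map(1,2,4)] by auto
  have ob: "c \<in> ob C" "b' \<in> ob C" "shO C a \<in> ob C"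
    using Hom_ob[OF w] Hom_ob[OF v'] by auto
  \<comment> \<open>The translate by \<open>\<theta> = 0\<close> is the map to compare with \<open>(f, g, h)\<close>.\<close>
  have "(triangle2 C u v w, tri_map2 f g k, triangle2 C u' v' w') \<in> DA 2"
    using dist[OF zero_Hom[OF ob(3,2)]] zero_cmp[OF w ob(2)] cmp_zero[OF v' ob(1)] plus_zero[OF k]
    by simp
  then obtain \<eta> where \<eta>: "\<eta> \<in> Hom C (shO C a) b'" and strike: "h \<oplus> neg_ar C k = v' \<cdot> \<eta> \<cdot> w"
    using lightning_strike[OF _ fgh] X(1) X'(1) by (auto simp: Hom_def)
  have \<theta>w: "\<theta> \<cdot> w \<in> Hom C c b'" and \<eta>w: "\<eta> \<cdot> w \<in> Hom C c b'"
    using cmp_Hom[OF w] \<theta> \<eta> by auto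
  note v\<theta>w = cmp_Hom[OF \<theta>w v'] and v\<eta>w = cmp_Hom[OF \<eta>w v']
  have "h = k \<oplus> v' \<cdot> \<eta> \<cdot> w"
    using plus_assoc[OF map(3) neg_Hom[OF k] k] neg_plus[OF k] plus_zero[OF map(3)] strike
      plus_commute[OF v\<eta>w k] by simp
  then have "h \<oplus> v' \<cdot> \<theta> \<cdot> w = k \<oplus> v' \<cdot> (\<eta> \<oplus> \<theta>) \<cdot> w"
    using plus_assoc[OF k v\<eta>w v\<theta>w] cmp_plus_right[OF \<eta>w \<theta>w v'] cmp_plus_left[OF w \<eta> \<theta>] by simp
  then show ?thesis
    using dist[OF plus_Hom[OF \<eta> \<theta>]] by simp
qed

end
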